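(* Let $X$ be a connected open subset of $\mathbb{C}^N$ with closure $\overline X$ in $\mathbb{C}^N$, and assume that the boundary $\partial X=\overline X\setminus X$ is $\mathcal{C}^0$ smooth. Let $n\in\mathbb{N}^*$ and let $A:\overline X\to\mathrm{Mat}(n\times n,\mathbb{C})$ be continuous on $\overline X$ and holomorphic in $X$. Denote by $\mathrm{split}\,A\subseteq\overline X$ the set of splitting points of the eigenvalues of $A$. If $\mathrm{split}\,A\neq\emptyset$, then there exist finitely many functions $h_1,\ldots,h_\ell:\overline X\to\mathbb{C}$, continuous on $\overline X$ and holomorphic in $X$, each of which is a finite sum of finite products of elements of $A$ (in the sense: a polynomial with integer coefficients in the entries of $A$), such that \[ \mathrm{split}\,A=\{\zeta\in\overline X: h_1(\zeta)=\ldots=h_\ell(\zeta)=0\} \] and \[ |h_j(\zeta)|\le (2n)^{6n^2}\,\|A(\zeta)\|^{2n^2}\quad\text{for all }\zeta\in\overline X\text{ and }1\le j\le\ell . \]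
   Context: $\mathbb{N}^*=\{1,2,\ldots\}$; $\mathrm{Mat}(n\times n,\mathbb{C})$ is the space of complex $n\times n$ matrices; $\|\Phi\|$ is the operator norm of $\Phi$ with respect to the Euclidean norm on $\mathbb{C}^n$. $\partial X$ is $\mathcal{C}^0$ smooth means: for each $\xi\in\partial X$ there is a neighborhood of $\xi$ in $\overline X$ which is homeomorphic to a set of the form $U\cap\{(x_1,\ldots,x_{2N})\in\mathbb{R}^{2N}: x_1\ge 0\}$, where $U$ is an open subset of $\mathbb{R}^{2N}$. A point $\xi\in\overline X$ is a splitting point of the eigenvalues of $A$ if for each neighborhood $U$ of $\xi$ in $\overline X$ there is $\zeta\in U$ such that $A(\zeta)$ has more eigenvalues (not counting multiplicities) than $A(\xi)$. *)

theory Defs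
  imports "HOL-Analysis.Analysis"
begin

text \<open>Holomorphy in several complex variables (meant for open \<open>X\<close>): existence of a complex-linear
  Frechet derivative at every point. Additivity and continuity of \<open>D\<close> are part of
  \<^const>\<open>has_derivative\<close>, so complex homogeneity is all that has to be added.\<close>

definition holomorphic_multi_on :: "(complex^'N \<Rightarrow> complex) \<Rightarrow> (complex^'N) set \<Rightarrow> bool"
    (infixl \<open>holomorphic'_multi'_on\<close> 50) where
  "f holomorphic_multi_on X \<longleftrightarrow>
     (\<forall>z\<in>X. \<exists>D. (f has_derivative D) (at z) \<and> (\<forall>c v. D (c *s v) = c * D v))"

definition matrix_holomorphic_on :: "(complex^'N \<Rightarrow> complex^'n^'n) \<Rightarrow> (complex^'N) set \<Rightarrow> bool"
    (infixl \<open>matrix'_holomorphic'_on\<close> 50) where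
  "A matrix_holomorphic_on X \<longleftrightarrow> (\<forall>i j. (\<lambda>z. A z $ i $ j) holomorphic_multi_on X)"

definition nbhd_within :: "'a::topological_space set \<Rightarrow> 'a \<Rightarrow> 'a set \<Rightarrow> bool" where
  "nbhd_within S x V \<longleftrightarrow>
     V \<subseteq> S \<and> (\<exists>W. openin (top_of_set S) W \<and> x \<in> W \<and> W \<subseteq> V)"

text \<open>\<^term>\<open>Euclidean_space k\<close> is the topological space \<open>\<real>\<^sup>k\<close> with coordinates indexed from \<open>0\<close>,
  so \<open>x 0\<close> is the first coordinate.\<close>

definition C0_smooth_boundary :: "(complex^'N) set \<Rightarrow> bool" where
  "C0_smooth_boundary X \<longleftrightarrow>
     (\<forall>\<xi> \<in> closure X - X. \<exists>V U.
        nbhd_within (closure X) \<xi> V \<and>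
        openin (Euclidean_space (2 * CARD('N))) U \<and>
        top_of_set V homeomorphic_space
          subtopology (Euclidean_space (2 * CARD('N))) (U \<inter> {x. x 0 \<ge> 0}))"

definition eigenvalues :: "complex^'n^'n \<Rightarrow> complex set" where
  "eigenvalues M = {c. \<exists>v. v \<noteq> 0 \<and> M *v v = c *s v}"

definition splitting_points ::
    "(complex^'N) set \<Rightarrow> (complex^'N \<Rightarrow> complex^'n^'n) \<Rightarrow> (complex^'N) set" where
  "splitting_points X A =
     {\<xi> \<in> closure X. \<forall>U. nbhd_within (closure X) \<xi> U \<longrightarrow>
        (\<exists>\<zeta>\<in>U. card (eigenvalues (A \<zeta>)) > card (eigenvalues (A \<xi>)))}"

definition matrix_opnorm :: "complex^'n^'n \<Rightarrow> real" where
  "matrix_opnorm M = onorm (\<lambda>v. M *v v)"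

text \<open>Polynomials with integer coefficients in the matrix entries: \<open>S\<close> is a finite set of exponent
  families, \<open>c \<alpha>\<close> the coefficient of the monomial with exponents \<open>\<alpha>\<close>.\<close>

definition int_polynomial_in_entries :: "(complex^'n^'n \<Rightarrow> complex) \<Rightarrow> bool" where
  "int_polynomial_in_entries p \<longleftrightarrow>
     (\<exists>(S :: ('n \<Rightarrow> 'n \<Rightarrow> nat) set) (c :: ('n \<Rightarrow> 'n \<Rightarrow> nat) \<Rightarrow> int).
        finite S \<and>
        (\<forall>M. p M = (\<Sum>\<alpha>\<in>S. of_int (c \<alpha>) * (\<Prod>i\<in>UNIV. \<Prod>j\<in>UNIV. (M $ i $ j) ^ \<alpha> i j))))"

end

theory Submission
  imports
    Defs
    "HOL-Complex_Analysis.Conformal_Mappings"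
    "Jordan_Normal_Form.Schur_Decomposition"
begin

text \<open>
  The number of distinct eigenvalues of a matrix can be read off from the traces of its powers. If
  \<open>w\<^sub>x\<close> denotes the algebraic multiplicity of the eigenvalue \<open>x\<close> of \<open>M\<close>, then
  \<open>tr (M^k) = \<Sum>\<^sub>x w\<^sub>x x^k\<close> (lemma \<open>eigenvalues_power_sums\<close>, from a Schur decomposition). So the Hankel
  matrix \<open>(tr (M^(i+j)))\<close>, \<open>0 \<le> i, j < m\<close>, is \<open>V\<^sup>T W V\<close>, where \<open>V\<close> is the Vandermonde matrix with
  one row for each distinct eigenvalue and \<open>W\<close> is the diagonal matrix of the multiplicities.
  As long as \<open>M\<close> has at most \<open>m\<close> eigenvalues, the determinant \<open>D\<^sub>m(M)\<close> of the Hankel matrix is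
  therefore nonzero exactly if there are \<open>m\<close> of them (lemma \<open>eigenvalue_hankel_det_nonzero_iff\<close>).
  This determinant is an integer polynomial in the entries of \<open>M\<close>, and it is homogeneous of degree \<open>m(m-1)\<close>.

  Let \<open>m\<close> be the largest number of eigenvalues that \<open>A\<close> attains on the closure of \<open>X\<close>. Then
  \<open>D\<^sub>m(A(\<zeta>)) = 0\<close> says that \<open>A(\<zeta>)\<close> has fewer than \<open>m\<close> eigenvalues. This set contains all splitting points,
  as no point can have more than \<open>m\<close> eigenvalues. Conversely, \<open>D\<^sub>m \<circ> A\<close> is holomorphic in \<open>X\<close> and, by
  continuity, not identically zero there, so by the identity theorem its nonzero set is dense in the
  closure of \<open>X\<close>: every point with fewer than \<open>m\<close> eigenvalues is a limit of points with \<open>m\<close>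
  eigenvalues, hence a splitting point (lemma \<open>splitting_points_eq_zeros\<close>).

  It remains to raise the degree, because the bound asks for exactly the power \<open>2n\<^sup>2\<close> of the norm, for
  small as well as for large matrices. The functions \<open>h\<^sub>i\<^sub>j = D\<^sub>m(A) a\<^sub>i\<^sub>j^e\<close> with \<open>e = 2n\<^sup>2 - m(m-1)\<close> have the
  right degree. Passing from \<open>D\<^sub>m(A)\<close> to these \<open>n\<^sup>2\<close> functions adds only zeros of \<open>A\<close> to the common zero
  set, and there \<open>D\<^sub>m(A)\<close> vanishes anyway: the zero matrix has just one eigenvalue, whereas \<open>m \<ge> 2\<close> if
  there is a splitting point. The constant comes from the Leibniz formula, which has \<open>m!\<close> terms, each
  a product of \<open>m\<close> traces with \<open>\<bar>tr (M^k)\<bar> \<le> n \<parallel>M\<parallel>^k\<close>.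
\<close>

no_notation vec_index (infixl \<open>$\<close> 100)
hide_const (open) Matrix.mat Matrix.row Matrix.col Determinant.det

section \<open>Integer polynomials in the matrix entries\<close>

text \<open>Sums and products of polynomials lead to sums over index sets in which an exponent family may occur
  several times; collecting equal monomials brings them into the form of the definition.\<close>

lemma int_polynomial_in_entries_family:
  fixes e :: "'x \<Rightarrow> 'n::finite \<Rightarrow> 'n \<Rightarrow> nat"
  assumes "finite T"
    and p: "\<And>M. p M = (\<Sum>x\<in>T. of_int (c x) * (\<Prod>i\<in>UNIV. \<Prod>j\<in>UNIV. (M $ i $ j) ^ e x i j))"
  shows "int_polynomial_in_entries p"
  unfolding int_polynomial_in_entries_def
proof (intro exI conjI allI)
  fix M :: "complex^'n^'n"
  let ?mono = "\<lambda>\<alpha>. \<Prod>i\<in>UNIV. \<Prod>j\<in>UNIV. (M $ i $ j) ^ \<alpha> i j"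
  have "p M = (\<Sum>\<alpha>\<in>e ` T. \<Sum>x\<in>{x\<in>T. e x = \<alpha>}. of_int (c x) * ?mono (e x))"
    unfolding p by (rule sum.image_gen[OF \<open>finite T\<close>])
  also have "\<dots> = (\<Sum>\<alpha>\<in>e ` T. of_int (\<Sum>x\<in>{x\<in>T. e x = \<alpha>}. c x) * ?mono \<alpha>)"
    by (intro sum.cong refl) (simp add: sum_distrib_right)
  finally show "p M = (\<Sum>\<alpha>\<in>e ` T. of_int (\<Sum>x\<in>{x\<in>T. e x = \<alpha>}. c x) * ?mono \<alpha>)" .
qed (use assms in simp)

lemma int_polynomial_in_entries_of_int: "int_polynomial_in_entries (\<lambda>M. of_int a)"
  by (rule int_polynomial_in_entries_family[where T = "{()}" and c = "\<lambda>_. a" and e = "\<lambda>_ _ _. 0"])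
    auto

lemma int_polynomial_in_entries_entry:
  fixes i j :: "'n::finite"
  shows "int_polynomial_in_entries (\<lambda>M. M $ i $ j)"
proof (rule int_polynomial_in_entries_family[where T = "{()}" and c = "\<lambda>_. 1"
      and e = "\<lambda>_ i' j'. if i' = i then if j' = j then 1 else 0 else 0"])
  fix M :: "complex^'n^'n"
  have "(\<Prod>j'\<in>UNIV. (M $ i' $ j') ^ (if i' = i then if j' = j then 1 else 0 else 0))
      = (if i' = i then M $ i $ j else 1)" for i'
  proof (cases "i' = i")
    case True
    have "(M $ i $ j') ^ (if j' = j then 1 else 0) = (if j' = j then M $ i $ j else 1)" for j'
      by simp
    then show ?thesis using True by (simp add: prod.delta)
  qed simp
  then show "M $ i $ j = (\<Sum>x\<in>{()}. of_int 1 * (\<Prod>i'\<in>UNIV. \<Prod>j'\<in>UNIV.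
      (M $ i' $ j') ^ (if i' = i then if j' = j then 1 else 0 else 0)))"
    by simp
qed simp

lemma int_polynomial_in_entries_add:
  fixes p q :: "complex^'n^'n \<Rightarrow> complex"
  assumes "int_polynomial_in_entries p" "int_polynomial_in_entries q"
  shows "int_polynomial_in_entries (\<lambda>M. p M + q M)"
proof -
  obtain S c where S: "finite S"
    "\<And>M. p M = (\<Sum>\<alpha>\<in>S. of_int (c \<alpha>) * (\<Prod>i\<in>UNIV. \<Prod>j\<in>UNIV. (M $ i $ j) ^ \<alpha> i j))"
    using assms(1) unfolding int_polynomial_in_entries_def by blast
  obtain S' c' where S': "finite S'"
    "\<And>M. q M = (\<Sum>\<alpha>\<in>S'. of_int (c' \<alpha>) * (\<Prod>i\<in>UNIV. \<Prod>j\<in>UNIV. (M $ i $ j) ^ \<alpha> i j))"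
    using assms(2) unfolding int_polynomial_in_entries_def by blast
  show ?thesis
    by (rule int_polynomial_in_entries_family[where T = "S <+> S'" and c = "case_sum c c'"
          and e = "case_sum id id"]) (use S S' in \<open>simp_all add: sum.Plus\<close>)
qed

lemma int_polynomial_in_entries_mult:
  fixes p q :: "complex^'n^'n \<Rightarrow> complex"
  assumes "int_polynomial_in_entries p" "int_polynomial_in_entries q"
  shows "int_polynomial_in_entries (\<lambda>M. p M * q M)"
proof -
  obtain S c where S: "finite S"
    "\<And>M. p M = (\<Sum>\<alpha>\<in>S. of_int (c \<alpha>) * (\<Prod>i\<in>UNIV. \<Prod>j\<in>UNIV. (M $ i $ j) ^ \<alpha> i j))"
    using assms(1) unfolding int_polynomial_in_entries_def by blast
  obtain S' c' where S': "finite S'"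
    "\<And>M. q M = (\<Sum>\<alpha>\<in>S'. of_int (c' \<alpha>) * (\<Prod>i\<in>UNIV. \<Prod>j\<in>UNIV. (M $ i $ j) ^ \<alpha> i j))"
    using assms(2) unfolding int_polynomial_in_entries_def by blast
  show ?thesis
  proof (rule int_polynomial_in_entries_family[where T = "S \<times> S'" and c = "\<lambda>(\<alpha>, \<beta>). c \<alpha> * c' \<beta>"
        and e = "\<lambda>(\<alpha>, \<beta>) i j. \<alpha> i j + \<beta> i j"])
    fix M :: "complex^'n^'n"
    show "p M * q M = (\<Sum>x\<in>S \<times> S'. of_int (case x of (\<alpha>, \<beta>) \<Rightarrow> c \<alpha> * c' \<beta>) *
        (\<Prod>i\<in>UNIV. \<Prod>j\<in>UNIV. M $ i $ j ^ (case x of (\<alpha>, \<beta>) \<Rightarrow> \<lambda>i j. \<alpha> i j + \<beta> i j) i j))"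
      unfolding S(2) S'(2) sum_product sum.cartesian_product
      by (intro sum.cong) (auto simp: power_add prod.distrib)
  qed (use S S' in simp)
qed

lemma int_polynomial_in_entries_sum:
  assumes "\<And>x. x \<in> I \<Longrightarrow> int_polynomial_in_entries (p x)"
  shows "int_polynomial_in_entries (\<lambda>M. \<Sum>x\<in>I. p x M)"
  using assms
proof (induction I rule: infinite_finite_induct)
  case (insert x F)
  then show ?case by (simp add: int_polynomial_in_entries_add)
qed (use int_polynomial_in_entries_of_int[of 0] in simp_all)

lemma int_polynomial_in_entries_prod:
  assumes "\<And>x. x \<in> I \<Longrightarrow> int_polynomial_in_entries (p x)"
  shows "int_polynomial_in_entries (\<lambda>M. \<Prod>x\<in>I. p x M)"
  using assms
proof (induction I rule: infinite_finite_induct)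
  case (insert x F)
  then show ?case by (simp add: int_polynomial_in_entries_mult)
qed (use int_polynomial_in_entries_of_int[of 1] in simp_all)

lemma int_polynomial_in_entries_power:
  assumes "int_polynomial_in_entries p"
  shows "int_polynomial_in_entries (\<lambda>M. p M ^ k)"
  using int_polynomial_in_entries_prod[of "{..<k}" "\<lambda>_. p"] assms by simp

section \<open>Holomorphic functions of several variables\<close>

lemma holomorphic_multi_on_const: "(\<lambda>z. a) holomorphic_multi_on X"
  unfolding holomorphic_multi_on_def
  by (intro ballI exI[where x = "\<lambda>_. 0"]) auto

lemma holomorphic_multi_on_add:
  assumes "f holomorphic_multi_on X" "g holomorphic_multi_on X"
  shows "(\<lambda>z. f z + g z) holomorphic_multi_on X"
  unfolding holomorphic_multi_on_def
proof
  fix z assume "z \<in> X"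
  then obtain F G where
    "(f has_derivative F) (at z)" "\<forall>c v. F (c *s v) = c * F v"
    "(g has_derivative G) (at z)" "\<forall>c v. G (c *s v) = c * G v"
    using assms unfolding holomorphic_multi_on_def by meson
  then show "\<exists>D. ((\<lambda>z. f z + g z) has_derivative D) (at z) \<and> (\<forall>c v. D (c *s v) = c * D v)"
    by (intro exI[where x = "\<lambda>v. F v + G v"]) (auto simp: algebra_simps intro!: derivative_intros)
qed

lemma holomorphic_multi_on_mult:
  assumes "f holomorphic_multi_on X" "g holomorphic_multi_on X"
  shows "(\<lambda>z. f z * g z) holomorphic_multi_on X"
  unfolding holomorphic_multi_on_def
proof
  fix z assume "z \<in> X"
  then obtain F G where
    "(f has_derivative F) (at z)" "\<forall>c v. F (c *s v) = c * F v"
    "(g has_derivative G) (at z)" "\<forall>c v. G (c *s v) = c * G v"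
    using assms unfolding holomorphic_multi_on_def by meson
  then show "\<exists>D. ((\<lambda>z. f z * g z) has_derivative D) (at z) \<and> (\<forall>c v. D (c *s v) = c * D v)"
    by (intro exI[where x = "\<lambda>v. f z * G v + F v * g z"])
      (auto simp: algebra_simps intro!: has_derivative_eq_rhs[OF has_derivative_mult])
qed

lemma holomorphic_multi_on_sum:
  assumes "\<And>x. x \<in> I \<Longrightarrow> f x holomorphic_multi_on X"
  shows "(\<lambda>z. \<Sum>x\<in>I. f x z) holomorphic_multi_on X"
  using assms
  by (induction I rule: infinite_finite_induct)
    (simp_all add: holomorphic_multi_on_const holomorphic_multi_on_add)

lemma holomorphic_multi_on_prod:
  assumes "\<And>x. x \<in> I \<Longrightarrow> f x holomorphic_multi_on X"
  shows "(\<lambda>z. \<Prod>x\<in>I. f x z) holomorphic_multi_on X"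
  using assms
  by (induction I rule: infinite_finite_induct)
    (simp_all add: holomorphic_multi_on_const holomorphic_multi_on_mult)

lemma holomorphic_multi_on_power:
  assumes "f holomorphic_multi_on X"
  shows "(\<lambda>z. f z ^ k) holomorphic_multi_on X"
  using holomorphic_multi_on_prod[of "{..<k}" "\<lambda>_. f"] assms by simp

lemma int_polynomial_in_entries_holomorphic:
  assumes "int_polynomial_in_entries p" "A matrix_holomorphic_on X"
  shows "(\<lambda>z. p (A z)) holomorphic_multi_on X"
proof -
  obtain S c where S:
    "\<And>M. p M = (\<Sum>\<alpha>\<in>S. of_int (c \<alpha>) * (\<Prod>i\<in>UNIV. \<Prod>j\<in>UNIV. (M $ i $ j) ^ \<alpha> i j))"
    using assms(1) unfolding int_polynomial_in_entries_def by blast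
  show ?thesis
    unfolding S using assms(2) unfolding matrix_holomorphic_on_def
    by (intro holomorphic_multi_on_sum holomorphic_multi_on_mult holomorphic_multi_on_const
        holomorphic_multi_on_prod holomorphic_multi_on_power) auto
qed

lemma int_polynomial_in_entries_continuous:
  assumes "int_polynomial_in_entries p" "continuous_on S A"
  shows "continuous_on S (\<lambda>z. p (A z))"
proof -
  obtain T c where T:
    "\<And>M. p M = (\<Sum>\<alpha>\<in>T. of_int (c \<alpha>) * (\<Prod>i\<in>UNIV. \<Prod>j\<in>UNIV. (M $ i $ j) ^ \<alpha> i j))"
    using assms(1) unfolding int_polynomial_in_entries_def by blast
  show ?thesis
    unfolding T by (intro continuous_intros assms(2))
qed

text \<open>The identity theorem in one variable, applied on the complex line that joins a point \<open>w\<close> of the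
  open zero set to \<open>u\<close>. The parameters for which this line stays in the ball form a convex set, which
  is where the shape of the domain enters.\<close>

lemma holomorphic_multi_zero_ball:
  fixes f :: "complex^'N \<Rightarrow> complex"
  assumes hol: "f holomorphic_multi_on ball z r"
    and T: "open T" "w \<in> T" "w \<in> ball z r" "\<And>u. u \<in> T \<Longrightarrow> f u = 0"
    and u: "u \<in> ball z r"
  shows "f u = 0"
proof -
  define line where "line t = w + t *s (u - w)" for t :: complex
  define L where "L = line -` ball z r"
  have deriv_line: "(line has_derivative (\<lambda>t. t *s (u - w))) (at t within A)" for t A
  proof -
    have "bounded_linear (\<lambda>t. t *s d)" for d :: "complex^'N"
      by (rule linear_conv_bounded_linear[THEN iffD1], rule linearI)
        (auto simp: Finite_Cartesian_Product.vec_eq_iff algebra_simps)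
    then show ?thesis
      unfolding line_def by (auto intro!: derivative_eq_intros bounded_linear_imp_has_derivative)
  qed
  have cont_line: "continuous_on A line" for A
    by (rule has_derivative_continuous_on[OF deriv_line])
  have "convex L"
  proof (rule convexI)
    fix s t and a b :: real
    assume "s \<in> L" "t \<in> L" and ab: "0 \<le> a" "0 \<le> b" "a + b = 1"
    have "line (a *\<^sub>R s + b *\<^sub>R t) = (a + b) *\<^sub>R w + (a *\<^sub>R s + b *\<^sub>R t) *s (u - w)"
      using ab by (simp add: line_def)
    also have "\<dots> = a *\<^sub>R line s + b *\<^sub>R line t"
      by (simp add: line_def Finite_Cartesian_Product.vec_eq_iff algebra_simps)
    also have "\<dots> \<in> ball z r"
      using convexD[OF convex_ball] \<open>s \<in> L\<close> \<open>t \<in> L\<close> ab unfolding L_def by blast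
    finally show "a *\<^sub>R s + b *\<^sub>R t \<in> L" by (simp add: L_def)
  qed
  have open_L: "open L" and open_T: "open (L \<inter> line -` T)"
    unfolding L_def using cont_line[of UNIV] T(1) by (auto intro!: open_vimage open_Int)
  have hol_line: "(f \<circ> line) holomorphic_on L"
    unfolding holomorphic_on_def
  proof
    fix t assume "t \<in> L"
    then obtain D where D: "(f has_derivative D) (at (line t))" "\<forall>c v. D (c *s v) = c * D v"
      using hol unfolding L_def holomorphic_multi_on_def by blast
    have "((f \<circ> line) has_derivative D \<circ> (\<lambda>t. t *s (u - w))) (at t within L)"
      using D(1) deriv_line by (auto intro: diff_chain_within has_derivative_at_withinI)
    moreover have "D \<circ> (\<lambda>t. t *s (u - w)) = (*) (D (u - w))"
    proof
      fix s
      have "D (s *s (u - w)) = s * D (u - w)" using D(2) by blast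
      then show "(D \<circ> (\<lambda>t. t *s (u - w))) s = D (u - w) * s"
        by (simp only: o_apply mult.commute[of s])
    qed
    ultimately show "(f \<circ> line) field_differentiable at t within L"
      unfolding field_differentiable_def has_field_derivative_def by metis
  qed
  have "0 \<in> L \<inter> line -` T" "1 \<in> L"
    using T(2,3) u by (simp_all add: L_def line_def)
  then have nonempty: "L \<inter> line -` T \<noteq> {}" and "1 \<in> L" by blast+
  have "(f \<circ> line) 1 = 0"
  proof (rule analytic_continuation_open[where s = "L \<inter> line -` T" and s' = L
        and f = "f \<circ> line" and g = "\<lambda>_. 0" and z = 1])
    show "(f \<circ> line) t = 0" if "t \<in> L \<inter> line -` T" for t
      using that T(4)[of "line t"] by simp
  qed (use open_T open_L nonempty \<open>convex L\<close> \<open>1 \<in> L\<close> hol_line in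
      \<open>simp_all add: convex_connected\<close>)
  then show ?thesis by (simp add: line_def)
qed

text \<open>By connectedness it suffices that the interior of the zero set is relatively closed in \<open>X\<close>. If
  a ball contained in \<open>X\<close> meets this interior, the previous lemma puts the whole ball into it.\<close>

lemma holomorphic_multi_identity:
  fixes f :: "complex^'N \<Rightarrow> complex"
  assumes X: "open X" "connected X" and hol: "f holomorphic_multi_on X"
    and T: "open T" "T \<inter> X \<noteq> {}" "\<And>u. u \<in> T \<inter> X \<Longrightarrow> f u = 0"
    and "x \<in> X"
  shows "f x = 0"
proof -
  define Z where "Z = interior {z\<in>X. f z = 0}"
  have "Z \<subseteq> X" unfolding Z_def using interior_subset by blast
  have "open Z" by (simp add: Z_def)
  have "T \<inter> X \<subseteq> Z"
    unfolding Z_def using T X by (intro interior_maximal) auto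
  then have "Z \<noteq> {}" using T(2) by blast
  have "\<exists>e>0. ball z e \<subseteq> (X - Z)" if z: "z \<in> X - Z" for z
  proof -
    obtain r where r: "r > 0" "ball z r \<subseteq> X"
      using z X(1) by (auto simp: open_contains_ball)
    have "ball z r \<inter> Z = {}"
    proof (rule ccontr)
      assume "ball z r \<inter> Z \<noteq> {}"
      then obtain w where w: "w \<in> ball z r" "w \<in> Z" by blast
      have "f u = 0" if "u \<in> ball z r" for u
      proof (rule holomorphic_multi_zero_ball)
        show "f holomorphic_multi_on ball z r"
          using hol r unfolding holomorphic_multi_on_def by blast
        show "f u = 0" if "u \<in> Z" for u
          using that interior_subset unfolding Z_def by blast
      qed (use w \<open>open Z\<close> that in auto)
      then have "ball z r \<subseteq> Z"
        unfolding Z_def using r by (intro interior_maximal) auto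
      then show False using z r(1) centre_in_ball[of z r] by blast
    qed
    then show ?thesis using r by blast
  qed
  then have "open (X - Z)"
    unfolding open_contains_ball by blast
  then have "X - Z = {}"
    using connectedD[OF X(2) \<open>open Z\<close>] \<open>Z \<subseteq> X\<close> \<open>Z \<noteq> {}\<close> by blast
  then show ?thesis
    using \<open>x \<in> X\<close> interior_subset unfolding Z_def by blast
qed

section \<open>Traces of matrix powers\<close>

primrec mat_pow :: "'a::semiring_1^'n^'n \<Rightarrow> nat \<Rightarrow> 'a^'n^'n" where
  "mat_pow M 0 = mat 1"
| "mat_pow M (Suc k) = mat_pow M k ** M"

lemma int_polynomial_in_entries_mat_pow:
  "int_polynomial_in_entries (\<lambda>M :: complex^'n^'n. mat_pow M k $ i $ j)"
proof (induction k arbitrary: j)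
  case 0
  show ?case
    by (simp add: Finite_Cartesian_Product.mat_def int_polynomial_in_entries_of_int[of 0, simplified]
        int_polynomial_in_entries_of_int[of 1, simplified])
next
  case (Suc k)
  then show ?case
    by (auto simp: matrix_matrix_mult_def intro!: int_polynomial_in_entries_sum
        int_polynomial_in_entries_mult int_polynomial_in_entries_entry)
qed

lemma int_polynomial_in_entries_trace_mat_pow:
  "int_polynomial_in_entries (\<lambda>M :: complex^'n^'n. trace (mat_pow M k))"
  unfolding trace_def by (intro int_polynomial_in_entries_sum int_polynomial_in_entries_mat_pow)

lemma matrix_opnorm_nonneg: "0 \<le> matrix_opnorm M"
  unfolding matrix_opnorm_def by (simp add: onorm_pos_le)

lemma norm_mat_pow_mult_vec:
  fixes M :: "complex^'n^'n"
  shows "norm (mat_pow M k *v x) \<le> matrix_opnorm M ^ k * norm x"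
proof (induction k arbitrary: x)
  case (Suc k)
  have "norm (mat_pow M k *v (M *v x)) \<le> matrix_opnorm M ^ k * norm (M *v x)"
    by (rule Suc.IH)
  also have "\<dots> \<le> matrix_opnorm M ^ k * (matrix_opnorm M * norm x)"
    unfolding matrix_opnorm_def
    by (intro mult_left_mono onorm) (simp_all add: onorm_pos_le)
  finally show ?case
    by (simp add: matrix_vector_mul_assoc mult_ac)
qed simp

lemma norm_mat_pow_entry_le:
  fixes M :: "complex^'n^'n"
  shows "norm (mat_pow M k $ i $ j) \<le> matrix_opnorm M ^ k"
proof -
  have "mat_pow M k $ i $ j = (mat_pow M k *v axis j 1) $ i"
    by (simp add: matrix_vector_mult_def axis_def if_distrib cong: if_cong)
  also have "norm \<dots> \<le> norm (mat_pow M k *v axis j 1)"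
    by (rule Finite_Cartesian_Product.norm_nth_le)
  also have "\<dots> \<le> matrix_opnorm M ^ k * norm (axis j (1::complex) :: complex^'n)"
    by (rule norm_mat_pow_mult_vec)
  finally show ?thesis by (simp add: norm_eq_sqrt_inner inner_axis_axis)
qed

lemma norm_entry_le:
  fixes M :: "complex^'n^'n"
  shows "norm (M $ i $ j) \<le> matrix_opnorm M"
  using norm_mat_pow_entry_le[of M 1 i j] by simp

lemma norm_trace_mat_pow_le:
  fixes M :: "complex^'n^'n"
  shows "norm (trace (mat_pow M k)) \<le> real CARD('n) * matrix_opnorm M ^ k"
  unfolding trace_def
  by (rule sum_norm_bound) (rule norm_mat_pow_entry_le)

section \<open>Eigenvalues and traces of powers\<close>

text \<open>The bijection \<open>b\<close> enumerates the index type. Numbered rows and columns give a meaning to triangular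
  form and hence to a Schur decomposition.\<close>

definition jnf_mat :: "(nat \<Rightarrow> 'n) \<Rightarrow> 'a^'n^'n \<Rightarrow> 'a mat" where
  "jnf_mat b M = Matrix.mat CARD('n) CARD('n) (\<lambda>(i, j). M $ b i $ b j)"

lemma jnf_mat_carrier [simp]:
  "jnf_mat b (M :: 'a^'n^'n) \<in> carrier_mat CARD('n) CARD('n)"
  by (simp add: jnf_mat_def)

lemma jnf_mat_mult:
  fixes M N :: "'a::comm_ring_1^'n^'n"
  assumes "bij_betw b {0..<CARD('n)} (UNIV :: 'n set)"
  shows "jnf_mat b (M ** N) = jnf_mat b M * jnf_mat b N"
  by (rule eq_matI)
    (auto simp: jnf_mat_def matrix_matrix_mult_def scalar_prod_def
      sum.reindex_bij_betw[OF assms, symmetric])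

lemma jnf_mat_pow:
  fixes M :: "'a::comm_ring_1^'n^'n"
  assumes "bij_betw b {0..<CARD('n)} (UNIV :: 'n set)"
  shows "jnf_mat b (mat_pow M k) = jnf_mat b M ^\<^sub>m k"
proof (induction k)
  case 0
  have "b i = b j \<longleftrightarrow> i = j" if "i < CARD('n)" "j < CARD('n)" for i j
    using assms that unfolding bij_betw_def inj_on_def by auto
  then show ?case
    by (auto intro!: eq_matI simp: jnf_mat_def Finite_Cartesian_Product.mat_def)
qed (simp add: jnf_mat_mult[OF assms])

lemma trace_eq_sum_jnf_mat:
  fixes M :: "'a::comm_ring_1^'n^'n"
  assumes "bij_betw b {0..<CARD('n)} (UNIV :: 'n set)"
  shows "trace M = (\<Sum>i<CARD('n). jnf_mat b M $$ (i, i))"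
  unfolding trace_def sum.reindex_bij_betw[OF assms, symmetric]
  by (rule sum.cong) (auto simp: jnf_mat_def)

lemma eigenvalues_eq_jnf_mat:
  fixes M :: "complex^'n^'n"
  assumes b: "bij_betw b {0..<CARD('n)} (UNIV :: 'n set)"
  shows "eigenvalues M = {c. eigenvalue (jnf_mat b M) c}"
proof -
  let ?n = "CARD('n)"
  have dim: "dim_row (jnf_mat b M) = ?n" by (simp add: jnf_mat_def)
  have mult: "(jnf_mat b M *\<^sub>v Matrix.vec ?n (\<lambda>i. v $ b i)) = Matrix.vec ?n (\<lambda>i. (M *v v) $ b i)"
    for v
    by (rule eq_vecI) (auto simp: jnf_mat_def matrix_vector_mult_def scalar_prod_def
        sum.reindex_bij_betw[OF b, symmetric])
  have to_jnf: "\<exists>w. w \<in> carrier_vec (dim_row (jnf_mat b M)) \<and> w \<noteq> 0\<^sub>v (dim_row (jnf_mat b M)) \<and>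
      jnf_mat b M *\<^sub>v w = c \<cdot>\<^sub>v w" if v: "v \<noteq> 0" "M *v v = c *s v" for c v
  proof (intro exI conjI)
    let ?w = "Matrix.vec ?n (\<lambda>i. v $ b i)"
    show "?w \<in> carrier_vec (dim_row (jnf_mat b M))" by (simp add: dim)
    obtain l where "v $ l \<noteq> 0" using v(1) by (auto simp: Finite_Cartesian_Product.vec_eq_iff)
    moreover obtain i where "i < ?n" "b i = l"
      using b unfolding bij_betw_def by (metis UNIV_I atLeastLessThan_iff imageE)
    ultimately have "vec_index ?w i \<noteq> vec_index (0\<^sub>v ?n) i" by simp
    then show "?w \<noteq> 0\<^sub>v (dim_row (jnf_mat b M))" unfolding dim by metis
    show "jnf_mat b M *\<^sub>v ?w = c \<cdot>\<^sub>v ?w"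
      unfolding mult v(2) by (rule eq_vecI) auto
  qed
  have of_jnf: "\<exists>v. v \<noteq> 0 \<and> M *v v = c *s v"
    if w: "w \<in> carrier_vec (dim_row (jnf_mat b M))" "w \<noteq> 0\<^sub>v (dim_row (jnf_mat b M))"
      "jnf_mat b M *\<^sub>v w = c \<cdot>\<^sub>v w" for c w
  proof (intro exI conjI)
    let ?v = "(\<chi> l. vec_index w (the_inv_into {0..<?n} b l)) :: complex^'n"
    have inv: "the_inv_into {0..<?n} b (b i) = i" if "i < ?n" for i
      using b that by (auto simp: bij_betw_def the_inv_into_f_f)
    have w_eq: "Matrix.vec ?n (\<lambda>i. ?v $ b i) = w"
      using w(1) by (intro eq_vecI) (auto simp: inv dim)
    show "?v \<noteq> 0"
    proof
      assume "?v = 0"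
      then have "w = 0\<^sub>v ?n" by (subst w_eq[symmetric]) auto
      then show False using w(2) dim by simp
    qed
    have *: "(M *v ?v) $ b i = c * ?v $ b i" if "i < ?n" for i
    proof -
      have "vec_index (jnf_mat b M *\<^sub>v Matrix.vec ?n (\<lambda>i. ?v $ b i)) i
          = vec_index (c \<cdot>\<^sub>v Matrix.vec ?n (\<lambda>i. ?v $ b i)) i"
        unfolding w_eq w(3) ..
      then show ?thesis unfolding mult using that by simp
    qed
    show "M *v ?v = c *s ?v"
      unfolding Finite_Cartesian_Product.vec_eq_iff
    proof
      fix l
      obtain i where "i < ?n" "b i = l"
        using b unfolding bij_betw_def by (metis UNIV_I atLeastLessThan_iff imageE)
      then show "(M *v ?v) $ l = (c *s ?v) $ l" using * by auto
    qed
  qed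
  show ?thesis
    unfolding eigenvalues_def eigenvalue_def eigenvector_def using to_jnf of_jnf by blast
qed

lemma upper_triangular_pow_diag:
  fixes B :: "'a::comm_ring_1 mat"
  assumes B: "B \<in> carrier_mat n n" "upper_triangular B" and "i < n"
  shows "(B ^\<^sub>m k) $$ (i, i) = B $$ (i, i) ^ k"
proof -
  \<comment> \<open>The induction needs the zeros below the diagonal of the power as well.\<close>
  have "(B ^\<^sub>m k) $$ (i, j) = (if i = j then B $$ (i, i) ^ k else 0)"
    if "j \<le> i" "i < n" for i j
    using that
  proof (induction k arbitrary: i j)
    case 0
    then show ?case using B by auto
  next
    case (Suc k)
    have "(B ^\<^sub>m Suc k) $$ (i, j) = (\<Sum>l<n. (B ^\<^sub>m k) $$ (i, l) * B $$ (l, j))"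
      using B Suc.prems pow_carrier_mat[OF B(1), of k]
      by (auto simp: scalar_prod_def lessThan_atLeast0)
    also have "\<dots> = (\<Sum>l<n. if l = i then (B ^\<^sub>m k) $$ (i, i) * B $$ (i, j) else 0)"
    proof (rule sum.cong)
      fix l assume "l \<in> {..<n}"
      then show "(B ^\<^sub>m k) $$ (i, l) * B $$ (l, j)
          = (if l = i then (B ^\<^sub>m k) $$ (i, i) * B $$ (i, j) else 0)"
        using Suc.IH[of l i] upper_triangularD[OF B(2), of j l] B(1) Suc.prems
        by (cases l i rule: linorder_cases) auto
    qed simp
    also have "\<dots> = B $$ (i, i) ^ k * B $$ (i, j)"
      using Suc by simp
    also have "\<dots> = (if i = j then B $$ (i, i) ^ Suc k else 0)"
      using upper_triangularD[OF B(2), of j i] B(1) Suc.prems by (auto simp: mult.commute)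
    finally show ?case .
  qed
  then show ?thesis using \<open>i < n\<close> by simp
qed

lemma sum_diag_mult_commute:
  fixes S T :: "'a::comm_ring_1 mat"
  assumes "S \<in> carrier_mat n n" "T \<in> carrier_mat n n"
  shows "(\<Sum>i<n. (S * T) $$ (i, i)) = (\<Sum>i<n. (T * S) $$ (i, i))"
proof -
  have "(\<Sum>i<n. (S * T) $$ (i, i)) = (\<Sum>i<n. \<Sum>l<n. S $$ (i, l) * T $$ (l, i))"
    using assms by (intro sum.cong) (auto simp: scalar_prod_def lessThan_atLeast0)
  also have "\<dots> = (\<Sum>l<n. \<Sum>i<n. T $$ (l, i) * S $$ (i, l))"
    by (subst sum.swap) (simp add: mult.commute)
  also have "\<dots> = (\<Sum>l<n. (T * S) $$ (l, l))"
    using assms by (intro sum.cong) (auto simp: scalar_prod_def lessThan_atLeast0)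
  finally show ?thesis .
qed

text \<open>The \<open>d i\<close> are the diagonal entries of a triangular matrix similar to \<open>M\<close>. They are the roots of the
  characteristic polynomial, and the diagonal of the \<open>k\<close>-th power consists of their \<open>k\<close>-th powers.\<close>

lemma eigenvalues_power_sums:
  fixes M :: "complex^'n^'n"
  obtains d where "eigenvalues M = d ` {..<CARD('n)}"
    and "\<And>k. trace (mat_pow M k) = (\<Sum>i<CARD('n). d i ^ k)"
proof -
  let ?n = "CARD('n)"
  obtain b where b: "bij_betw b {0..<?n} (UNIV :: 'n set)"
    using ex_bij_betw_nat_finite[of "UNIV :: 'n set"] by auto
  let ?J = "jnf_mat b M"
  obtain as where as: "char_poly ?J = (\<Prod>a\<leftarrow>as. [:- a, 1:])" "length as = ?n"
    using char_poly_factorized[OF jnf_mat_carrier] by blast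
  obtain B P Q where "schur_decomposition ?J as = (B, P, Q)"
    by (cases "schur_decomposition ?J as") auto
  from schur_decomposition[OF jnf_mat_carrier as(1) this]
  have sim: "similar_mat_wit ?J B P Q" and tri: "upper_triangular B" and diag: "diag_mat B = as"
    by auto
  have carrier: "B \<in> carrier_mat ?n ?n" "P \<in> carrier_mat ?n ?n" "Q \<in> carrier_mat ?n ?n"
    and QP: "Q * P = 1\<^sub>m ?n"
    using similar_mat_witD2[OF jnf_mat_carrier sim] by auto
  have "eigenvalues M = set as"
  proof -
    have "eigenvalue ?J c \<longleftrightarrow> c \<in> set as" for c
      unfolding eigenvalue_root_char_poly[OF jnf_mat_carrier] as(1)
      by (auto simp: poly_prod_list prod_list_zero_iff)
    then show ?thesis using eigenvalues_eq_jnf_mat[OF b] by auto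
  qed
  also have "\<dots> = (\<lambda>i. B $$ (i, i)) ` {..<?n}"
    using diag carrier(1) by (auto simp: diag_mat_def)
  finally have eig: "eigenvalues M = (\<lambda>i. B $$ (i, i)) ` {..<?n}" .
  have "trace (mat_pow M k) = (\<Sum>i<?n. (B $$ (i, i)) ^ k)" for k
  proof -
    have Bk: "B ^\<^sub>m k \<in> carrier_mat ?n ?n" using carrier by simp
    have "trace (mat_pow M k) = (\<Sum>i<?n. (P * B ^\<^sub>m k * Q) $$ (i, i))"
      unfolding trace_eq_sum_jnf_mat[OF b] jnf_mat_pow[OF b] similar_mat_wit_pow_id[OF sim] ..
    also have "\<dots> = (\<Sum>i<?n. (Q * (P * B ^\<^sub>m k)) $$ (i, i))"
      using carrier Bk by (intro sum_diag_mult_commute) auto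
    also have "Q * (P * B ^\<^sub>m k) = B ^\<^sub>m k"
      using carrier Bk QP by (simp add: assoc_mult_mat[symmetric, of _ ?n ?n _ ?n _ ?n])
    also have "(\<Sum>i<?n. (B ^\<^sub>m k) $$ (i, i)) = (\<Sum>i<?n. (B $$ (i, i)) ^ k)"
      using upper_triangular_pow_diag[OF carrier(1) tri] by (intro sum.cong) auto
    finally show ?thesis .
  qed
  then show thesis using eig that by blast
qed

lemma finite_eigenvalues: "finite (eigenvalues (M :: complex^'n^'n))"
  and card_eigenvalues_le: "card (eigenvalues M) \<le> CARD('n)"
  and card_eigenvalues_pos: "0 < card (eigenvalues M)"
proof -
  obtain d where d: "eigenvalues M = d ` {..<CARD('n)}"
    using eigenvalues_power_sums[of M] by metis
  then show fin: "finite (eigenvalues M)" by simp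
  show "card (eigenvalues M) \<le> CARD('n)"
    unfolding d using card_image_le[of "{..<CARD('n)}" d] by simp
  show "0 < card (eigenvalues M)"
  proof -
    have "d 0 \<in> eigenvalues M" unfolding d by simp
    then show ?thesis using fin by (auto simp: card_gt_0_iff)
  qed
qed

section \<open>Hankel determinants of power sums\<close>

lemma poly_eq_sum_lessThan:
  fixes p :: "'a::comm_ring_1 poly"
  assumes "degree p < m"
  shows "poly p x = (\<Sum>i<m. coeff p i * x ^ i)"
proof -
  have "poly p x = poly (\<Sum>i\<le>m - 1. monom (coeff p i) i) x"
    using poly_as_sum_of_monoms'[of p "m - 1"] assms by simp
  also have "\<dots> = (\<Sum>i\<le>m - 1. coeff p i * x ^ i)"
    by (simp add: poly_sum poly_monom)
  also have "{..m - 1} = {..<m}" using assms by auto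
  finally show ?thesis .
qed

text \<open>Applied to the coefficient vector of a polynomial \<open>q\<close> of degree less than \<open>m\<close>, the Hankel matrix gives
  the vector with entries \<open>\<Sum>\<^sub>x w\<^sub>x x^i q(x)\<close>. If \<open>E\<close> has fewer than \<open>m\<close> points, the polynomial with simple
  zeros at \<open>E\<close> has degree less than \<open>m\<close> and gives a nonzero vector in the kernel. If \<open>E\<close> has \<open>m\<close> points
  and \<open>q\<close> is in the kernel, pairing with polynomials that vanish on \<open>E\<close> except at one point \<open>y\<close> shows
  that \<open>q(y) = 0\<close>; so \<open>q\<close> has \<open>m\<close> zeros, too many for its degree.\<close>

lemma hankel_det_nonzero_iff:
  fixes w :: "'a::field \<Rightarrow> 'a"
  assumes fin: "finite E" and w: "\<And>x. x \<in> E \<Longrightarrow> w x \<noteq> 0" and card: "card E \<le> m"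
  shows "Determinant.det (Matrix.mat m m (\<lambda>(i, j). \<Sum>x\<in>E. w x * x ^ (i + j))) \<noteq> 0 \<longleftrightarrow> card E = m"
proof -
  define H where "H = Matrix.mat m m (\<lambda>(i, j). \<Sum>x\<in>E. w x * x ^ (i + j))"
  have H: "H \<in> carrier_mat m m" by (simp add: H_def)
  have Hv: "vec_index (H *\<^sub>v v) i = (\<Sum>x\<in>E. w x * x ^ i * (\<Sum>j<m. vec_index v j * x ^ j))"
    if "v \<in> carrier_vec m" "i < m" for v i
  proof -
    have "vec_index (H *\<^sub>v v) i = (\<Sum>j<m. (\<Sum>x\<in>E. w x * x ^ (i + j)) * vec_index v j)"
      using that by (auto simp: H_def scalar_prod_def lessThan_atLeast0)
    also have "\<dots> = (\<Sum>x\<in>E. w x * x ^ i * (\<Sum>j<m. vec_index v j * x ^ j))"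
      unfolding sum_distrib_right sum_distrib_left
      by (subst sum.swap) (simp add: power_add mult_ac)
    finally show ?thesis .
  qed
  let ?g = "\<lambda>F. \<Prod>x\<in>F. [:- x, 1:]"
  have deg_g: "degree (?g F) = card F" for F :: "'a set"
    by (subst degree_prod_eq_sum_degree) auto
  have "Determinant.det H = 0" if "card E < m"
  proof -
    define v where "v = Matrix.vec m (coeff (?g E))"
    have "v \<in> carrier_vec m" by (simp add: v_def)
    moreover have "vec_index v (card E) \<noteq> vec_index (0\<^sub>v m) (card E)"
    proof -
      have "coeff (?g E) (card E) \<noteq> 0"
        using deg_g[of E] by (metis (no_types, lifting) leading_coeff_0_iff fin pCons_eq_0_iff
            prod_zero_iff zero_neq_one)
      then show ?thesis using that by (simp add: v_def)
    qed
    then have "v \<noteq> 0\<^sub>v m" by metis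
    moreover have "H *\<^sub>v v = 0\<^sub>v m"
    proof (rule eq_vecI)
      fix i assume "i < dim_vec (0\<^sub>v m :: 'a Matrix.vec)"
      then have i: "i < m" by simp
      have "(\<Sum>j<m. vec_index v j * x ^ j) = 0" if "x \<in> E" for x
      proof -
        have "(\<Sum>j<m. vec_index v j * x ^ j) = poly (?g E) x"
          using \<open>card E < m\<close> deg_g[of E] by (simp add: poly_eq_sum_lessThan v_def)
        then show ?thesis using that fin by (auto simp: poly_prod)
      qed
      then show "vec_index (H *\<^sub>v v) i = vec_index (0\<^sub>v m) i"
        using Hv[OF \<open>v \<in> carrier_vec m\<close> i] i by simp
    qed (simp add: H_def)
    ultimately show ?thesis
      using det_0_iff_vec_prod_zero[OF H] by blast
  qed
  moreover have "Determinant.det H \<noteq> 0" if "card E = m"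
  proof
    assume "Determinant.det H = 0"
    then obtain v where v: "v \<in> carrier_vec m" "v \<noteq> 0\<^sub>v m" "H *\<^sub>v v = 0\<^sub>v m"
      using det_0_iff_vec_prod_zero[OF H] by blast
    define q where "q = (\<Sum>j<m. monom (vec_index v j) j)"
    have coeff_q: "coeff q j = vec_index v j" if "j < m" for j
      using that by (simp add: q_def coeff_sum)
    have poly_q: "poly q x = (\<Sum>j<m. vec_index v j * x ^ j)" for x
      by (simp add: q_def poly_sum poly_monom)
    have "q \<noteq> 0"
    proof
      assume "q = 0"
      then have "v = 0\<^sub>v m" using coeff_q v(1) by (intro eq_vecI) auto
      then show False using v(2) by simp
    qed
    have "poly q y = 0" if "y \<in> E" for y
    proof -
      define g where "g = ?g (E - {y})"
      have "degree g < m"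
        using deg_g[of "E - {y}"] \<open>card E = m\<close> fin that card_gt_0_iff[of E]
        by (auto simp: g_def)
      have g0: "poly g x = 0" if "x \<in> E - {y}" for x
        using that fin by (auto simp: g_def poly_prod)
      have "0 = (\<Sum>i<m. coeff g i * vec_index (H *\<^sub>v v) i)"
        unfolding v(3) by simp
      also have "\<dots> = (\<Sum>i<m. \<Sum>x\<in>E. w x * poly q x * (coeff g i * x ^ i))"
        using Hv[OF v(1)] by (intro sum.cong) (auto simp: poly_q sum_distrib_left mult_ac)
      also have "\<dots> = (\<Sum>x\<in>E. w x * poly q x * poly g x)"
        unfolding poly_eq_sum_lessThan[OF \<open>degree g < m\<close>] sum_distrib_left by (rule sum.swap)
      also have "\<dots> = w y * poly q y * poly g y"
        using sum.remove[OF fin that, of "\<lambda>x. w x * poly q x * poly g x"] g0 by simp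
      finally show "poly q y = 0"
        using w[OF that] fin by (auto simp: g_def poly_prod)
    qed
    then have "E \<subseteq> {x. poly q x = 0}" by blast
    then have "card E \<le> card {x. poly q x = 0}"
      by (rule card_mono[OF poly_roots_finite[OF \<open>q \<noteq> 0\<close>]])
    also have "\<dots> \<le> degree q" by (rule card_poly_roots_bound[OF \<open>q \<noteq> 0\<close>])
    also have "degree q < m"
    proof (cases "m = 0")
      case True
      then show ?thesis using \<open>q \<noteq> 0\<close> by (simp add: q_def)
    next
      case False
      then have "degree q \<le> m - 1"
        unfolding q_def by (intro degree_sum_le) (auto intro: order.trans[OF degree_monom_le])
      then show ?thesis using False by simp
    qed
    finally show False using \<open>card E = m\<close> by simp
  qed
  ultimately show ?thesis using card unfolding H_def by linarith
qed

text \<open>By the Cauchy-Binet formula this is the sum, over the \<open>m\<close>-element subfamilies of the eigenvalues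
  listed with multiplicity, of the squares of the Vandermonde determinants of the subfamilies. If
  \<open>M\<close> has exactly \<open>m\<close> distinct eigenvalues, it is their discriminant times the product of their
  multiplicities.\<close>

definition eigenvalue_hankel_det :: "nat \<Rightarrow> complex^'n^'n \<Rightarrow> complex" where
  "eigenvalue_hankel_det m M =
    Determinant.det (Matrix.mat m m (\<lambda>(i, j). trace (mat_pow M (i + j))))"

lemma eigenvalue_hankel_det_nonzero_iff:
  fixes M :: "complex^'n^'n"
  assumes "card (eigenvalues M) \<le> m"
  shows "eigenvalue_hankel_det m M \<noteq> 0 \<longleftrightarrow> card (eigenvalues M) = m"
proof -
  obtain d where d: "eigenvalues M = d ` {..<CARD('n)}"
    and tr: "\<And>k. trace (mat_pow M k) = (\<Sum>i<CARD('n). d i ^ k)"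
    using eigenvalues_power_sums[of M] by metis
  \<comment> \<open>the algebraic multiplicity of \<open>x\<close>\<close>
  define w :: "complex \<Rightarrow> complex" where "w x = of_nat (card {i \<in> {..<CARD('n)}. d i = x})" for x
  have "trace (mat_pow M k) = (\<Sum>x\<in>eigenvalues M. w x * x ^ k)" for k
    unfolding tr d w_def by (subst sum.image_gen[of _ _ d]) auto
  moreover have "w x \<noteq> 0" if "x \<in> eigenvalues M" for x
    using that unfolding w_def d by auto
  ultimately show ?thesis
    unfolding eigenvalue_hankel_det_def
    using hankel_det_nonzero_iff[of "eigenvalues M" w m] assms finite_eigenvalues[of M] by simp
qed

lemma eigenvalue_hankel_det_Leibniz:
  "eigenvalue_hankel_det m M =
    (\<Sum>\<sigma> | \<sigma> permutes {0..<m}. of_int (sign \<sigma>) * (\<Prod>i=0..<m. trace (mat_pow M (i + \<sigma> i))))"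
  unfolding eigenvalue_hankel_det_def
  proof (subst det_def'[of _ m], simp, intro sum.cong refl arg_cong2[of _ _ _ _ "(*)"] prod.cong)
  fix \<sigma> i assume "\<sigma> \<in> {\<sigma>. \<sigma> permutes {0..<m}}" "i \<in> {0..<m}"
  then have "i < m" "\<sigma> i < m"
    using permutes_in_image[of \<sigma> "{0..<m}" i] by auto
  then show "Matrix.mat m m (\<lambda>(i, j). trace (mat_pow M (i + j))) $$ (i, \<sigma> i)
      = trace (mat_pow M (i + \<sigma> i))"
    by simp
qed

lemma int_polynomial_in_entries_hankel_det:
  "int_polynomial_in_entries (eigenvalue_hankel_det m :: complex^'n^'n \<Rightarrow> complex)"
  unfolding eigenvalue_hankel_det_Leibniz[abs_def]
  by (intro int_polynomial_in_entries_sum int_polynomial_in_entries_mult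
      int_polynomial_in_entries_of_int int_polynomial_in_entries_prod
      int_polynomial_in_entries_trace_mat_pow)

text \<open>Every term of the Leibniz formula has the same degree in the entries, since the exponents
  \<open>i + \<sigma> i\<close> always add up to \<open>m (m - 1)\<close>.\<close>

lemma norm_eigenvalue_hankel_det_le:
  fixes M :: "complex^'n^'n"
  shows "norm (eigenvalue_hankel_det m M)
    \<le> fact m * real CARD('n) ^ m * matrix_opnorm M ^ (m * (m - 1))"
proof -
  have "norm (of_int (sign \<sigma>) * (\<Prod>i=0..<m. trace (mat_pow M (i + \<sigma> i))))
      \<le> real CARD('n) ^ m * matrix_opnorm M ^ (m * (m - 1))" if \<sigma>: "\<sigma> permutes {0..<m}" for \<sigma>
  proof -
    have "(\<Sum>i=0..<m. i + \<sigma> i) = 2 * (\<Sum>i=0..<m. i)"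
      using sum.permute[OF \<sigma>, of id] by (simp add: sum.distrib)
    also have "\<dots> = m * (m - 1)"
      by (induction m) (auto simp: algebra_simps)
    finally have exponent: "(\<Sum>i=0..<m. i + \<sigma> i) = m * (m - 1)" .
    have "norm (of_int (sign \<sigma>) * (\<Prod>i=0..<m. trace (mat_pow M (i + \<sigma> i))) :: complex)
        = (\<Prod>i=0..<m. norm (trace (mat_pow M (i + \<sigma> i))))"
      by (simp add: norm_mult prod_norm[symmetric] sign_def)
    also have "\<dots> \<le> (\<Prod>i=0..<m. real CARD('n) * matrix_opnorm M ^ (i + \<sigma> i))"
      by (intro prod_mono) (auto intro: norm_trace_mat_pow_le)
    also have "\<dots> = real CARD('n) ^ m * matrix_opnorm M ^ (m * (m - 1))"
      unfolding exponent[symmetric] power_sum prod.distrib by simp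
    finally show ?thesis .
  qed
  then have "norm (eigenvalue_hankel_det m M)
      \<le> of_nat (card {\<sigma>. \<sigma> permutes {0..<m}}) * (real CARD('n) ^ m * matrix_opnorm M ^ (m * (m - 1)))"
    unfolding eigenvalue_hankel_det_Leibniz by (intro sum_norm_bound) auto
  then show ?thesis
    by (simp add: card_permutations[of _ m] mult.assoc)
qed

section \<open>The splitting set\<close>

text \<open>No point has more than \<open>m\<close> eigenvalues, so a point with \<open>m\<close> eigenvalues cannot split. For the
  converse the identity theorem makes the points with \<open>m\<close> eigenvalues dense: a determinant that
  vanishes on a nonempty open part of \<open>X\<close> vanishes on \<open>X\<close>, hence on its closure, although it is
  nonzero at \<open>\<zeta>0\<close>.\<close>

lemma splitting_points_eq_zeros:
  fixes X :: "(complex^'N) set" and A :: "complex^'N \<Rightarrow> complex^'n^'n"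
  assumes X: "open X" "connected X"
    and A: "continuous_on (closure X) A" "A matrix_holomorphic_on X"
    and m: "\<And>\<zeta>. \<zeta> \<in> closure X \<Longrightarrow> card (eigenvalues (A \<zeta>)) \<le> m"
    and attained: "\<zeta>0 \<in> closure X" "card (eigenvalues (A \<zeta>0)) = m"
  shows "splitting_points X A = {\<zeta> \<in> closure X. eigenvalue_hankel_det m (A \<zeta>) = 0}"
proof -
  let ?h = "\<lambda>\<zeta>. eigenvalue_hankel_det m (A \<zeta>)"
  have h_iff: "?h \<zeta> = 0 \<longleftrightarrow> card (eigenvalues (A \<zeta>)) < m" if "\<zeta> \<in> closure X" for \<zeta>
    using eigenvalue_hankel_det_nonzero_iff[OF m[OF that]] m[OF that] by linarith
  have h_hol: "?h holomorphic_multi_on X"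
    by (rule int_polynomial_in_entries_holomorphic[OF int_polynomial_in_entries_hankel_det A(2)])
  have h_cont: "continuous_on (closure X) ?h"
    by (rule int_polynomial_in_entries_continuous[OF int_polynomial_in_entries_hankel_det A(1)])
  have dense: "\<exists>\<zeta>\<in>T \<inter> X. ?h \<zeta> \<noteq> 0" if T: "open T" "T \<inter> X \<noteq> {}" for T
  proof (rule ccontr)
    assume "\<not> ?thesis"
    then have "?h x = 0" if "x \<in> X" for x
      using holomorphic_multi_identity[OF X h_hol T _ that] by blast
    then have "?h \<zeta>0 = 0"
      using continuous_constant_on_closure[OF h_cont _ attained(1)] by blast
    then show False using h_iff attained by simp
  qed
  show ?thesis
  proof (intro Set.set_eqI iffI)
    fix \<xi> assume \<xi>: "\<xi> \<in> splitting_points X A"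
    have "nbhd_within (closure X) \<xi> (closure X)"
      using \<xi> unfolding nbhd_within_def splitting_points_def by auto
    then obtain \<zeta> where "\<zeta> \<in> closure X" "card (eigenvalues (A \<xi>)) < card (eigenvalues (A \<zeta>))"
      using \<xi> unfolding splitting_points_def by blast
    then show "\<xi> \<in> {\<zeta> \<in> closure X. ?h \<zeta> = 0}"
      using \<xi> m[of \<zeta>] h_iff[of \<xi>] unfolding splitting_points_def by auto
  next
    fix \<xi> assume "\<xi> \<in> {\<zeta> \<in> closure X. ?h \<zeta> = 0}"
    then have \<xi>: "\<xi> \<in> closure X" "card (eigenvalues (A \<xi>)) < m"
      using h_iff by auto
    have "\<exists>\<zeta>\<in>U. card (eigenvalues (A \<zeta>)) > card (eigenvalues (A \<xi>))"
      if U: "nbhd_within (closure X) \<xi> U" for U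
    proof -
      obtain T where T: "open T" "\<xi> \<in> T" "T \<inter> closure X \<subseteq> U"
        using U unfolding nbhd_within_def openin_open by blast
      have "T \<inter> X \<noteq> {}"
        using \<xi>(1) T(1,2) open_Int_closure_eq_empty by blast
      then obtain \<zeta> where "\<zeta> \<in> T" "\<zeta> \<in> X" "?h \<zeta> \<noteq> 0"
        using dense[OF T(1)] by blast
      moreover from this have "\<zeta> \<in> closure X" using closure_subset by blast
      ultimately show ?thesis
        using T(3) h_iff[of \<zeta>] \<xi>(2) by (intro bexI[of _ \<zeta>]) auto
    qed
    then show "\<xi> \<in> splitting_points X A"
      using \<xi>(1) unfolding splitting_points_def by blast
  qed
qed

lemma fact_mult_power_le:
  assumes "m \<le> n" "1 \<le> n"
  shows "fact m * real n ^ m \<le> (2 * real n) ^ (6 * n\<^sup>2)"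
proof -
  have "(fact m :: real) \<le> real m ^ m"
    using fact_le_power[of m, where 'a = real] by simp
  also have "\<dots> \<le> real n ^ m" using assms by (intro power_mono) auto
  finally have "fact m * real n ^ m \<le> real n ^ m * real n ^ m"
    by (intro mult_right_mono) auto
  also have "\<dots> = real n ^ (2 * m)" by (simp add: mult_2 power_add)
  also have "\<dots> \<le> (2 * real n) ^ (2 * m)" by (intro power_mono) auto
  also have "\<dots> \<le> (2 * real n) ^ (6 * n\<^sup>2)"
  proof (rule power_increasing)
    have "m \<le> n * n" using assms by (meson le_square order.trans)
    then show "2 * m \<le> 6 * n\<^sup>2" by (simp add: power2_eq_square)
    show "1 \<le> 2 * real n" using assms by linarith
  qed
  finally show ?thesis .
qed

theorem theorem6p1:
  fixes X :: "(complex^'N) set"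
    and A :: "complex^'N \<Rightarrow> complex^'n^'n"
  assumes "open X" and "connected X"
    and "C0_smooth_boundary X"
    and "continuous_on (closure X) A"
    and "A matrix_holomorphic_on X"
    and "splitting_points X A \<noteq> {}"
  shows "\<exists>(l::nat) (h :: nat \<Rightarrow> complex^'N \<Rightarrow> complex).
           1 \<le> l \<and>
           (\<forall>j\<in>{1..l}.
              continuous_on (closure X) (h j) \<and>
              h j holomorphic_multi_on X \<and>
              (\<exists>p. int_polynomial_in_entries p \<and> (\<forall>\<zeta>\<in>closure X. h j \<zeta> = p (A \<zeta>)))) \<and>
           splitting_points X A = {\<zeta> \<in> closure X. \<forall>j\<in>{1..l}. h j \<zeta> = 0} \<and>
           (\<forall>j\<in>{1..l}. \<forall>\<zeta>\<in>closure X.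
              cmod (h j \<zeta>) \<le> (2 * real CARD('n)) ^ (6 * CARD('n)\<^sup>2)
                                * matrix_opnorm (A \<zeta>) ^ (2 * CARD('n)\<^sup>2))"
proof -
  let ?n = "CARD('n)"
  let ?N = "\<lambda>\<zeta>. card (eigenvalues (A \<zeta>))"
  obtain \<xi> where \<xi>: "\<xi> \<in> splitting_points X A" using assms(6) by blast
  then have "\<xi> \<in> closure X" by (simp add: splitting_points_def)
  define m where "m = Max (?N ` closure X)"
  have fin: "finite (?N ` closure X)"
    by (rule finite_subset[of _ "{..?n}"]) (auto intro: card_eigenvalues_le)
  have m: "?N \<zeta> \<le> m" if "\<zeta> \<in> closure X" for \<zeta>
    unfolding m_def using fin that by auto
  have "m \<in> ?N ` closure X"
    unfolding m_def using fin \<open>\<xi> \<in> closure X\<close> by (intro Max_in) auto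
  then obtain \<zeta>0 where \<zeta>0: "\<zeta>0 \<in> closure X" "?N \<zeta>0 = m" by auto
  have split_eq: "splitting_points X A = {\<zeta> \<in> closure X. eigenvalue_hankel_det m (A \<zeta>) = 0}"
    by (rule splitting_points_eq_zeros[OF assms(1,2,4,5) m \<zeta>0])
  have "m \<le> ?n" using \<zeta>0 card_eigenvalues_le[of "A \<zeta>0"] by simp
  have "?N \<xi> < m"
    using \<xi> eigenvalue_hankel_det_nonzero_iff[OF m[OF \<open>\<xi> \<in> closure X\<close>]] m[OF \<open>\<xi> \<in> closure X\<close>]
    unfolding split_eq by auto
  then have "2 \<le> m" using card_eigenvalues_pos[of "A \<xi>"] by linarith
  \<comment> \<open>what the degree \<open>m (m - 1)\<close> of the determinant lacks\<close>
  define e where "e = 2 * ?n\<^sup>2 - m * (m - 1)"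
  have "m * (m - 1) \<le> ?n * ?n" using \<open>m \<le> ?n\<close> by (intro mult_mono) auto
  then have e: "m * (m - 1) + e = 2 * ?n\<^sup>2"
    unfolding e_def power2_eq_square by linarith
  define p where "p = (\<lambda>ij (M :: complex^'n^'n).
    eigenvalue_hankel_det m M * (M $ fst ij $ snd ij) ^ e)"
  have p_poly: "int_polynomial_in_entries (p ij)" for ij
    unfolding p_def by (intro int_polynomial_in_entries_mult int_polynomial_in_entries_hankel_det
        int_polynomial_in_entries_power int_polynomial_in_entries_entry)
  \<comment> \<open>The extra factors vanish simultaneously only at the zero matrix, which has one eigenvalue.\<close>
  have p_zero: "(\<forall>ij. p ij M = 0) \<longleftrightarrow> eigenvalue_hankel_det m M = 0" for M
  proof
    assume 0: "\<forall>ij. p ij M = 0"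
    show "eigenvalue_hankel_det m M = 0"
    proof (rule ccontr)
      assume D: "eigenvalue_hankel_det m M \<noteq> 0"
      then have "M $ i $ j = 0" for i j
        using 0[rule_format, of "(i, j)"] by (simp add: p_def)
      then have "M = 0" by (simp add: Finite_Cartesian_Product.vec_eq_iff)
      then have "eigenvalues M \<subseteq> {0}"
        by (auto simp: eigenvalues_def Finite_Cartesian_Product.vec_eq_iff matrix_vector_mult_def)
      then have "card (eigenvalues M) \<le> 1"
        using card_mono[of "{0}" "eigenvalues M"] by simp
      then show False
        using eigenvalue_hankel_det_nonzero_iff[of M m] D \<open>2 \<le> m\<close> by linarith
    qed
  qed (simp add: p_def)
  have p_bound: "cmod (p ij M) \<le> (2 * real ?n) ^ (6 * ?n\<^sup>2) * matrix_opnorm M ^ (2 * ?n\<^sup>2)" for ij M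
  proof -
    have "cmod (p ij M)
        \<le> (fact m * real ?n ^ m * matrix_opnorm M ^ (m * (m - 1))) * matrix_opnorm M ^ e"
      unfolding p_def norm_mult norm_power
      by (intro mult_mono norm_eigenvalue_hankel_det_le power_mono norm_entry_le)
        (auto simp: matrix_opnorm_nonneg)
    also have "\<dots> = fact m * real ?n ^ m * matrix_opnorm M ^ (2 * ?n\<^sup>2)"
      unfolding e[symmetric] by (simp add: power_add)
    also have "\<dots> \<le> (2 * real ?n) ^ (6 * ?n\<^sup>2) * matrix_opnorm M ^ (2 * ?n\<^sup>2)"
      using \<open>m \<le> ?n\<close> by (intro mult_right_mono fact_mult_power_le) (auto simp: matrix_opnorm_nonneg)
    finally show ?thesis .
  qed
  let ?l = "CARD('n \<times> 'n)"
  obtain idx where idx: "bij_betw idx {1..?l} (UNIV :: ('n \<times> 'n) set)"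
    using ex_bij_betw_nat_finite_1[of "UNIV :: ('n \<times> 'n) set"] by auto
  define h where "h j \<zeta> = p (idx j) (A \<zeta>)" for j \<zeta>
  have h_zero: "(\<forall>j\<in>{1..?l}. h j \<zeta> = 0) \<longleftrightarrow> eigenvalue_hankel_det m (A \<zeta>) = 0" for \<zeta>
  proof -
    have "(\<forall>j\<in>{1..?l}. h j \<zeta> = 0) \<longleftrightarrow> (\<forall>ij\<in>idx ` {1..?l}. p ij (A \<zeta>) = 0)"
      unfolding h_def by blast
    also have "idx ` {1..?l} = UNIV" by (rule bij_betw_imp_surj_on[OF idx])
    finally show ?thesis using p_zero by simp
  qed
  show ?thesis
  proof (intro exI conjI ballI)
    show "1 \<le> ?l" using zero_less_card_finite[where 'a = "'n \<times> 'n"] by linarith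
    show "splitting_points X A = {\<zeta> \<in> closure X. \<forall>j\<in>{1..?l}. h j \<zeta> = 0}"
      unfolding h_zero by (rule split_eq)
    fix j
    show "continuous_on (closure X) (h j)"
      unfolding h_def[abs_def] by (rule int_polynomial_in_entries_continuous[OF p_poly assms(4)])
    show "h j holomorphic_multi_on X"
      unfolding h_def[abs_def] by (rule int_polynomial_in_entries_holomorphic[OF p_poly assms(5)])
    show "int_polynomial_in_entries (p (idx j))" by (rule p_poly)
    show "h j \<zeta> = p (idx j) (A \<zeta>)" for \<zeta> by (simp add: h_def)
    show "cmod (h j \<zeta>) \<le> (2 * real ?n) ^ (6 * ?n\<^sup>2) * matrix_opnorm (A \<zeta>) ^ (2 * ?n\<^sup>2)" for \<zeta>
      unfolding h_def by (rule p_bound)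
  qed
qed

end
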